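(* For $n>3$, the centralizer of the pure cactus group $PJ_n$ in the cactus group $J_n$ is trivial.
   Context: For $n \ge 2$, the cactus group $J_n$ is the group with generators $s_{p,q}$ for $1 \le p < q \le n$ and relations: (j1) $s_{p,q}^2 = 1$; (j2) $s_{p,q}s_{m,r} = s_{m,r}s_{p,q}$ whenever $[p,q]\cap[m,r]=\emptyset$; (j3) $s_{p,q}s_{m,r} = s_{p+q-r,\,p+q-m}\,s_{p,q}$ whenever $[m,r]\subset[p,q]$. There is a homomorphism $s\colon J_n\to S_n$ sending $s_{p,q}$ to the permutation of $\{1,\dots,n\}$ that reverses the order of $p,p+1,\dots,q$ and fixes all other elements. The pure cactus group $PJ_n$ is the kernel of $s$. *)

theory Defs
  imports "HOL-Algebra.Sym_Groups"
begin

section \<open>Groups given by generators and relations\<close>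

text \<open>The letter \<open>(x, True)\<close> stands for the generator \<open>x\<close>, and \<open>(x, False)\<close> for its
  formal inverse. A relation \<open>(l, r)\<close> stands for the equation \<open>l = r\<close>.\<close>

type_synonym 'g word = "('g \<times> bool) list"

definition words :: "'g set \<Rightarrow> 'g word set"
  where "words X = lists (X \<times> UNIV)"

inductive pres_eq :: "'g set \<Rightarrow> ('g word \<times> 'g word) set \<Rightarrow> 'g word \<Rightarrow> 'g word \<Rightarrow> bool"
  for X R where
  pres_eq_refl: "w \<in> words X \<Longrightarrow> pres_eq X R w w"
| pres_eq_sym: "pres_eq X R u v \<Longrightarrow> pres_eq X R v u"
| pres_eq_trans: "pres_eq X R u v \<Longrightarrow> pres_eq X R v w \<Longrightarrow> pres_eq X R u w"
| pres_eq_cancel: "u \<in> words X \<Longrightarrow> v \<in> words X \<Longrightarrow> x \<in> X \<Longrightarrow>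
    pres_eq X R (u @ [(x, b), (x, \<not> b)] @ v) (u @ v)"
| pres_eq_rel: "u \<in> words X \<Longrightarrow> v \<in> words X \<Longrightarrow> (l, r) \<in> R \<Longrightarrow>
    pres_eq X R (u @ l @ v) (u @ r @ v)"

definition pres_rel :: "'g set \<Rightarrow> ('g word \<times> 'g word) set \<Rightarrow> ('g word \<times> 'g word) set"
  where "pres_rel X R = {(u, v). pres_eq X R u v}"

definition presented_group :: "'g set \<Rightarrow> ('g word \<times> 'g word) set \<Rightarrow> 'g word set monoid"
  where "presented_group X R =
    \<lparr> carrier = words X // pres_rel X R,
      mult = (\<lambda>A B. \<Union>a\<in>A. \<Union>b\<in>B. pres_rel X R `` {a @ b}),
      one = pres_rel X R `` {[]} \<rparr>"

fun word_eval :: "('a, 'b) monoid_scheme \<Rightarrow> ('g \<Rightarrow> 'a) \<Rightarrow> 'g word \<Rightarrow> 'a" where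
  "word_eval G f [] = \<one>\<^bsub>G\<^esub>"
| "word_eval G f ((x, b) # w) = (if b then f x else inv\<^bsub>G\<^esub> (f x)) \<otimes>\<^bsub>G\<^esub> word_eval G f w"

text \<open>The map induced on a presented group by an assignment \<open>f\<close> of the generators. If \<open>f\<close>
  respects the relations, then \<open>word_eval G f\<close> is constant on each class and \<open>the_elem\<close>
  returns this constant value (see \<open>pres_map_class\<close>, \<open>pres_map_hom\<close>).\<close>

definition pres_map :: "('a, 'b) monoid_scheme \<Rightarrow> ('g \<Rightarrow> 'a) \<Rightarrow> 'g word set \<Rightarrow> 'a"
  where "pres_map G f C = the_elem (word_eval G f ` C)"

lemma words_append [simp]: "u @ v \<in> words X \<longleftrightarrow> u \<in> words X \<and> v \<in> words X"
  by (auto simp: words_def)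

lemma words_Nil [simp]: "[] \<in> words X"
  by (simp add: words_def)

lemma words_Cons [simp]: "(x, b) # w \<in> words X \<longleftrightarrow> x \<in> X \<and> w \<in> words X"
  by (auto simp: words_def)

lemma pres_eq_words:
  assumes "R \<subseteq> words X \<times> words X" "pres_eq X R u v"
  shows "u \<in> words X \<and> v \<in> words X"
  using assms(2,1) by (induction rule: pres_eq.induct) auto

lemma equiv_pres_rel:
  assumes "R \<subseteq> words X \<times> words X"
  shows "equiv (words X) (pres_rel X R)"
proof (rule equivI)
  show "pres_rel X R \<subseteq> words X \<times> words X"
    using pres_eq_words[OF assms] by (auto simp: pres_rel_def)
  show "refl_on (words X) (pres_rel X R)"
    by (auto simp: refl_on_def pres_rel_def intro: pres_eq_refl)
  show "sym (pres_rel X R)"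
    by (rule symI) (simp add: pres_rel_def pres_eq_sym)
  show "trans (pres_rel X R)"
    by (rule transI) (use pres_eq_trans in \<open>fastforce simp: pres_rel_def\<close>)
qed

lemma pres_eq_context:
  assumes "pres_eq X R u v" "a \<in> words X" "b \<in> words X"
  shows "pres_eq X R (a @ u @ b) (a @ v @ b)"
  using assms
proof (induction rule: pres_eq.induct)
  case (pres_eq_cancel u v x c)
  then show ?case using pres_eq.pres_eq_cancel[of "a @ u" X "v @ b" x R c] by simp
next
  case (pres_eq_rel u v l r)
  then show ?case using pres_eq.pres_eq_rel[of "a @ u" X "v @ b" l r R] by simp
next
  case (pres_eq_trans u v w)
  then show ?case by (auto intro: pres_eq.pres_eq_trans[of X R _ "a @ v @ b"])
next
  case (pres_eq_sym u v)
  then show ?case by (simp add: pres_eq.pres_eq_sym)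
next
  case (pres_eq_refl w)
  then show ?case by (simp add: pres_eq.pres_eq_refl)
qed

lemma pres_eq_append:
  assumes "R \<subseteq> words X \<times> words X" "pres_eq X R u u'" "pres_eq X R v v'"
  shows "pres_eq X R (u @ v) (u' @ v')"
proof -
  have "pres_eq X R (u @ v) (u' @ v)"
    using pres_eq_context[OF assms(2), of "[]" v] pres_eq_words[OF assms(1,3)] by simp
  moreover have "pres_eq X R (u' @ v) (u' @ v')"
    using pres_eq_context[OF assms(3), of u' "[]"] pres_eq_words[OF assms(1,2)] by simp
  ultimately show ?thesis by (rule pres_eq_trans)
qed

lemma presented_group_mult:
  assumes "R \<subseteq> words X \<times> words X" "u \<in> words X" "v \<in> words X"
  shows "pres_rel X R `` {u} \<otimes>\<^bsub>presented_group X R\<^esub> pres_rel X R `` {v}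
       = pres_rel X R `` {u @ v}"
proof -
  have eq: "pres_rel X R `` {a @ b} = pres_rel X R `` {u @ v}"
    if "pres_eq X R u a" "pres_eq X R v b" for a b
  proof -
    have "(u @ v, a @ b) \<in> pres_rel X R"
      using pres_eq_append[OF assms(1) that] by (simp add: pres_rel_def)
    then show ?thesis using equiv_class_eq[OF equiv_pres_rel[OF assms(1)]] by blast
  qed
  have ne: "u \<in> pres_rel X R `` {u}" "v \<in> pres_rel X R `` {v}"
    using assms by (auto simp: pres_rel_def intro: pres_eq_refl)
  have "(\<Union>a\<in>pres_rel X R `` {u}. \<Union>b\<in>pres_rel X R `` {v}. pres_rel X R `` {a @ b})
      = (\<Union>a\<in>pres_rel X R `` {u}. \<Union>b\<in>pres_rel X R `` {v}. pres_rel X R `` {u @ v})"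
    by (intro SUP_cong refl) (rule eq, auto simp: pres_rel_def)
  also have "\<dots> = pres_rel X R `` {u @ v}"
    using ne by blast
  finally show ?thesis by (simp add: presented_group_def)
qed

lemma presented_group_is_group:
  assumes "R \<subseteq> words X \<times> words X"
  shows "group (presented_group X R)"
proof (rule groupI)
  note mult = presented_group_mult[OF assms]
  have carr: "C \<in> carrier (presented_group X R) \<longleftrightarrow> (\<exists>w\<in>words X. C = pres_rel X R `` {w})" for C
    by (auto simp: presented_group_def quotient_def)
  have one: "\<one>\<^bsub>presented_group X R\<^esub> = pres_rel X R `` {[]}"
    by (simp add: presented_group_def)
  show "\<one>\<^bsub>presented_group X R\<^esub> \<in> carrier (presented_group X R)"
    using carr one words_Nil by blast
  fix A assume "A \<in> carrier (presented_group X R)"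
  then obtain a where a: "a \<in> words X" "A = pres_rel X R `` {a}" using carr by blast
  show "\<one>\<^bsub>presented_group X R\<^esub> \<otimes>\<^bsub>presented_group X R\<^esub> A = A"
    using mult[of "[]" a] a one by simp
  have "\<exists>b\<in>words X. pres_eq X R (b @ a) []"
    using a(1)
  proof (induction a)
    case Nil
    then show ?case by (intro bexI[of _ "[]"]) (auto intro: pres_eq_refl)
  next
    case (Cons l w)
    obtain x c where l: "l = (x, c)" by fastforce
    from Cons l obtain b where b: "b \<in> words X" "pres_eq X R (b @ w) []" by auto
    have "pres_eq X R (b @ [(x, \<not> c), (x, \<not> \<not> c)] @ w) (b @ w)"
      using Cons l b by (intro pres_eq_cancel[of b X w x R "\<not> c"]) auto
    then have "pres_eq X R ((b @ [(x, \<not> c)]) @ l # w) []"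
      using b(2) l pres_eq_trans[OF _ b(2)] by simp
    then show ?case using b l Cons by (intro bexI[of _ "b @ [(x, \<not> c)]"]) auto
  qed
  then obtain b where b: "b \<in> words X" "pres_eq X R (b @ a) []" by blast
  then have "pres_rel X R `` {b @ a} = pres_rel X R `` {[]}"
    using equiv_class_eq[OF equiv_pres_rel[OF assms]] by (auto simp: pres_rel_def)
  then show "\<exists>B\<in>carrier (presented_group X R). B \<otimes>\<^bsub>presented_group X R\<^esub> A = \<one>\<^bsub>presented_group X R\<^esub>"
    using mult[OF b(1) a(1)] a(2) b(1) carr one by metis
  fix B assume "B \<in> carrier (presented_group X R)"
  then obtain b where b: "b \<in> words X" "B = pres_rel X R `` {b}" using carr by blast
  show "A \<otimes>\<^bsub>presented_group X R\<^esub> B \<in> carrier (presented_group X R)"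
    using mult a b carr by (metis words_append)
  fix C assume "C \<in> carrier (presented_group X R)"
  then obtain c where c: "c \<in> words X" "C = pres_rel X R `` {c}" using carr by blast
  show "A \<otimes>\<^bsub>presented_group X R\<^esub> B \<otimes>\<^bsub>presented_group X R\<^esub> C
      = A \<otimes>\<^bsub>presented_group X R\<^esub> (B \<otimes>\<^bsub>presented_group X R\<^esub> C)"
    using mult a b c by simp
qed

context
  fixes G (structure) and f :: "'g \<Rightarrow> 'a" and X R
  assumes G: "group G" and f: "f \<in> X \<rightarrow> carrier G"
    and R: "R \<subseteq> words X \<times> words X"
    and resp: "\<And>l r. (l, r) \<in> R \<Longrightarrow> word_eval G f l = word_eval G f r"
begin

interpretation group G by (rule G)

lemma word_eval_closed: "w \<in> words X \<Longrightarrow> word_eval G f w \<in> carrier G"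
  by (induction w) (use f in \<open>auto simp: Pi_iff\<close>)

lemma word_eval_append:
  "u \<in> words X \<Longrightarrow> v \<in> words X \<Longrightarrow> word_eval G f (u @ v) = word_eval G f u \<otimes> word_eval G f v"
  by (induction u) (use f word_eval_closed in \<open>auto simp: m_assoc Pi_iff\<close>)

lemma word_eval_pres_eq: "pres_eq X R u v \<Longrightarrow> word_eval G f u = word_eval G f v"
proof (induction rule: pres_eq.induct)
  case (pres_eq_cancel u v x b)
  have "f x \<in> carrier G" using f pres_eq_cancel by auto
  then have "word_eval G f [(x, b), (x, \<not> b)] = \<one>" by simp
  then show ?case
    using pres_eq_cancel word_eval_closed
      word_eval_append[of u "[(x, b), (x, \<not> b)] @ v"] word_eval_append[of "[(x, b), (x, \<not> b)]" v]
      word_eval_append[of u v]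
    by simp
next
  case (pres_eq_rel u v l r)
  then have "l \<in> words X" "r \<in> words X" using R by auto
  then show ?case using pres_eq_rel resp by (simp add: word_eval_append)
qed auto

lemma pres_map_class:
  assumes "w \<in> words X"
  shows "pres_map G f (pres_rel X R `` {w}) = word_eval G f w"
proof -
  have "word_eval G f ` (pres_rel X R `` {w}) = {word_eval G f w}"
  proof (intro equalityI subsetI)
    fix y assume "y \<in> word_eval G f ` (pres_rel X R `` {w})"
    then obtain v where "pres_eq X R w v" "y = word_eval G f v" by (auto simp: pres_rel_def)
    then show "y \<in> {word_eval G f w}" using word_eval_pres_eq[of w v] by simp
  next
    fix y assume "y \<in> {word_eval G f w}"
    moreover have "w \<in> pres_rel X R `` {w}" using assms by (simp add: pres_rel_def pres_eq_refl)
    ultimately show "y \<in> word_eval G f ` (pres_rel X R `` {w})" by blast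
  qed
  then show ?thesis by (simp add: pres_map_def)
qed

lemma pres_map_hom: "pres_map G f \<in> hom (presented_group X R) G"
proof (rule homI)
  have carr: "C \<in> carrier (presented_group X R) \<longleftrightarrow> (\<exists>w\<in>words X. C = pres_rel X R `` {w})" for C
    by (auto simp: presented_group_def quotient_def)
  fix A assume "A \<in> carrier (presented_group X R)"
  then obtain a where a: "a \<in> words X" "A = pres_rel X R `` {a}" using carr by blast
  then show "pres_map G f A \<in> carrier G" by (simp add: pres_map_class word_eval_closed)
  fix B assume "B \<in> carrier (presented_group X R)"
  then obtain b where b: "b \<in> words X" "B = pres_rel X R `` {b}" using carr by blast
  show "pres_map G f (A \<otimes>\<^bsub>presented_group X R\<^esub> B) = pres_map G f A \<otimes> pres_map G f B"
    using a b by (simp add: presented_group_mult[OF R] pres_map_class word_eval_append)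
qed

end


section \<open>Cactus groups\<close>

definition cactus_gens :: "nat \<Rightarrow> (nat \<times> nat) set"
  where "cactus_gens n = {(p, q). 1 \<le> p \<and> p < q \<and> q \<le> n}"

abbreviation sgen :: "nat \<Rightarrow> nat \<Rightarrow> (nat \<times> nat) \<times> bool"
  where "sgen p q \<equiv> ((p, q), True)"

definition cactus_rels :: "nat \<Rightarrow> ((nat \<times> nat) word \<times> (nat \<times> nat) word) set"
  where "cactus_rels n =
    {([sgen p q, sgen p q], []) | p q. (p, q) \<in> cactus_gens n} \<union>
    {([sgen p q, sgen m r], [sgen m r, sgen p q]) | p q m r.
        (p, q) \<in> cactus_gens n \<and> (m, r) \<in> cactus_gens n \<and> {p..q} \<inter> {m..r} = {}} \<union>
    {([sgen p q, sgen m r], [sgen (p + q - r) (p + q - m), sgen p q]) | p q m r.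
        (p, q) \<in> cactus_gens n \<and> (m, r) \<in> cactus_gens n \<and> {m..r} \<subseteq> {p..q}}"

definition cactus_group :: "nat \<Rightarrow> (nat \<times> nat) word set monoid"
  where "cactus_group n = presented_group (cactus_gens n) (cactus_rels n)"

definition interval_reversal :: "nat \<times> nat \<Rightarrow> nat \<Rightarrow> nat"
  where "interval_reversal = (\<lambda>(p, q) i. if p \<le> i \<and> i \<le> q then p + q - i else i)"

definition cactus_perm :: "nat \<Rightarrow> (nat \<times> nat) word set \<Rightarrow> nat \<Rightarrow> nat"
  where "cactus_perm n = pres_map (sym_group n) interval_reversal"

definition pure_cactus_group :: "nat \<Rightarrow> (nat \<times> nat) word set set"
  where "pure_cactus_group n = kernel (cactus_group n) (sym_group n) (cactus_perm n)"

definition centralizer :: "('a, 'b) monoid_scheme \<Rightarrow> 'a set \<Rightarrow> 'a set"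
  where "centralizer G H = {g \<in> carrier G. \<forall>h\<in>H. g \<otimes>\<^bsub>G\<^esub> h = h \<otimes>\<^bsub>G\<^esub> g}"

lemma cactus_rels_words: "cactus_rels n \<subseteq> words (cactus_gens n) \<times> words (cactus_gens n)"
  by (auto simp: cactus_rels_def cactus_gens_def)

lemma cactus_group_is_group: "group (cactus_group n)"
  unfolding cactus_group_def by (rule presented_group_is_group[OF cactus_rels_words])

lemma interval_reversal_involutive: "interval_reversal x (interval_reversal x i) = i"
  by (cases x) (auto simp: interval_reversal_def)

lemma interval_reversal_in_sym_group:
  "interval_reversal \<in> cactus_gens n \<rightarrow> carrier (sym_group n)"
proof
  fix x assume x: "x \<in> cactus_gens n"
  have "bij (interval_reversal x)"
    by (rule o_bij[of "interval_reversal x"]) (simp_all add: fun_eq_iff interval_reversal_involutive)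
  moreover have "interval_reversal x i = i" if "i \<notin> {1..n}" for i
    using x that by (auto simp: interval_reversal_def cactus_gens_def)
  ultimately have "interval_reversal x permutes {1..n}"
    unfolding permutes_def by (metis bij_pointE)
  then show "interval_reversal x \<in> carrier (sym_group n)"
    by (simp add: sym_group_carrier)
qed

lemma interval_reversal_commute:
  assumes "{p..q} \<inter> {m..r} = {}"
  shows "interval_reversal (p, q) (interval_reversal (m, r) i)
       = interval_reversal (m, r) (interval_reversal (p, q) i)"
proof -
  have *: "j \<in> {p..q} \<Longrightarrow> j \<notin> {m..r}" for j using assms by blast
  have "i \<in> {p..q} \<Longrightarrow> p + q - i \<in> {p..q}" "i \<in> {m..r} \<Longrightarrow> m + r - i \<in> {m..r}" by auto
  then show ?thesis
    using *[of i] *[of "p + q - i"] *[of "m + r - i"] by (auto simp: interval_reversal_def)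
qed

lemma interval_reversal_nested:
  assumes "p \<le> m" "m < r" "r \<le> q"
  shows "interval_reversal (p, q) (interval_reversal (m, r) i)
       = interval_reversal (p + q - r, p + q - m) (interval_reversal (p, q) i)"
proof (cases "p \<le> i \<and> i \<le> q")
  case True
  then show ?thesis
    using assms by (cases "m \<le> i \<and> i \<le> r") (auto simp: interval_reversal_def)
next
  case False
  then show ?thesis using assms by (auto simp: interval_reversal_def)
qed

lemma cactus_rels_respected:
  assumes "(l, r) \<in> cactus_rels n"
  shows "word_eval (sym_group n) interval_reversal l = word_eval (sym_group n) interval_reversal r"
  using assms
  by (auto simp: cactus_rels_def cactus_gens_def sym_group_mult sym_group_one fun_eq_iff
      interval_reversal_involutive
      intro!: interval_reversal_commute interval_reversal_nested)

lemma cactus_perm_hom: "cactus_perm n \<in> hom (cactus_group n) (sym_group n)"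
  unfolding cactus_perm_def cactus_group_def
  by (rule pres_map_hom[OF sym_group_is_group interval_reversal_in_sym_group
        cactus_rels_words cactus_rels_respected])

lemma cactus_perm_gen:
  assumes "(p, q) \<in> cactus_gens n"
  shows "cactus_perm n (pres_rel (cactus_gens n) (cactus_rels n) `` {[sgen p q]})
       = interval_reversal (p, q)"
  unfolding cactus_perm_def
  using assms pres_map_class[OF sym_group_is_group interval_reversal_in_sym_group
        cactus_rels_words cactus_rels_respected, of n "[sgen p q]"]
  by (simp add: sym_group_mult sym_group_one)

end

theory Submission
  imports Defs "HOL-Algebra.Multiplicative_Group"
begin

text \<open>
  The group \<open>J\<^sub>n\<close> acts linearly on integer functions on the subsets of \<open>\<nat>\<close>: call two sets
  overlapping if they meet and neither contains the other; then the generator of the interval \<open>X\<close>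
  composes the reversal of \<open>X\<close> with the reflection of the right-angled Coxeter group
  whose generators are the sets and in which two of them commute iff they do not overlap.
  Acting on the constant function \<open>1\<close>, an element \<open>g\<close> produces a function that is negative
  at \<open>X\<close> exactly if \<open>s\<^sub>X\<close> is a left descent of \<open>g\<close>, that is, shortens \<open>g\<close>. Descents of one element never
  overlap, and lengths add in \<open>g h\<close> if the inverse of \<open>g\<close> and \<open>h\<close> have no common descent.

  For overlapping intervals \<open>X\<close>, \<open>A\<close>, the pure element \<open>h = (s\<^sub>X s\<^sub>A)\<^bsup>n!\<^esup>\<close> has the single descent
  \<open>X\<close>. If \<open>g\<close> commutes with \<open>h\<close> and has the descent \<open>A\<close>, then \<open>X\<close> is a descent of the inverse of \<open>g\<close>: otherwise
  \<open>g h = h g\<close> would be reduced on both sides and have the overlapping descents \<open>A\<close> and \<open>X\<close>.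
  Applying this twice to \<open>g\<close> and its inverse produces two overlapping descents of \<open>g\<close> whenever \<open>g\<close> has a
  descent other than \<open>[1,n]\<close>; this is where \<open>n > 3\<close> enters, since for \<open>n = 3\<close> the overlap
  graph of the proper intervals is bipartite. Hence \<open>g\<close> is trivial or \<open>s\<^bsub>1,n\<^esub>\<close>, and the latter is excluded
  by the same argument for \<open>X = [1,n-1]\<close> and its mirror image \<open>[2,n]\<close>.
\<close>

section \<open>Overlapping sets and reflections\<close>

definition overlap :: "nat set \<Rightarrow> nat set \<Rightarrow> bool"
  where "overlap c d \<longleftrightarrow> \<not> (c \<inter> d = {} \<or> c \<subseteq> d \<or> d \<subseteq> c)"

definition ivl :: "nat \<times> nat \<Rightarrow> nat set"
  where "ivl x = {fst x..snd x}"

lemma ivl_simp [simp]: "ivl (p, q) = {p..q}"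
  by (simp add: ivl_def)

lemma overlap_irrefl [simp]: "\<not> overlap c c"
  by (simp add: overlap_def)

lemma overlap_sym: "overlap c d \<Longrightarrow> overlap d c"
  by (auto simp: overlap_def)

lemma overlap_image: "inj f \<Longrightarrow> overlap (f ` c) (f ` d) \<longleftrightarrow> overlap c d"
  by (simp add: overlap_def inj_image_subset_iff image_Int[symmetric])

section \<open>Action of interval reversals on sets\<close>

lemma inj_interval_reversal: "inj (interval_reversal x)"
  by (metis injI interval_reversal_involutive)

lemma interval_reversal_image_image [simp]:
  "interval_reversal x ` interval_reversal x ` c = c"
  by (simp add: image_image interval_reversal_involutive)

lemma interval_reversal_image_superset:
  assumes "ivl x \<subseteq> c"
  shows "interval_reversal x ` c = c"
proof -
  have "interval_reversal x i \<in> c" if "i \<in> c" for i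
  proof (cases "i \<in> ivl x")
    case True
    then have "interval_reversal x i \<in> ivl x" by (cases x) (auto simp: interval_reversal_def)
    then show ?thesis using assms by blast
  next
    case False
    then show ?thesis using that by (cases x) (auto simp: interval_reversal_def)
  qed
  then have "interval_reversal x ` c \<subseteq> c" by blast
  moreover from this have "c \<subseteq> interval_reversal x ` c"
    by (metis image_mono interval_reversal_image_image)
  ultimately show ?thesis by blast
qed

lemma interval_reversal_image_disjoint:
  assumes "c \<inter> ivl x = {}"
  shows "interval_reversal x ` c = c"
proof -
  have "interval_reversal x i = i" if "i \<in> c" for i
    using assms that by (cases x) (auto simp: interval_reversal_def)
  then show ?thesis by simp
qed

lemma interval_reversal_image_ivl [simp]: "interval_reversal x ` ivl x = ivl x"
  by (simp add: interval_reversal_image_superset)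

lemma interval_reversal_image_nested:
  assumes "p \<le> m" "m \<le> r" "r \<le> q"
  shows "interval_reversal (p, q) ` {m..r} = {p + q - r..p + q - m}"
proof -
  have "interval_reversal (p, q) ` {m..r} = (\<lambda>i. p + q - i) ` {m..r}"
    using assms by (intro image_cong) (auto simp: interval_reversal_def)
  also have "\<dots> = {p + q - r..p + q - m}"
  proof (intro equalityI subsetI)
    fix j assume "j \<in> {p + q - r..p + q - m}"
    then have "j = p + q - (p + q - j)" "p + q - j \<in> {m..r}" using assms by auto
    then show "j \<in> (\<lambda>i. p + q - i) ` {m..r}" by blast
  qed auto
  finally show ?thesis .
qed

lemma interval_reversal_image_eq_ivl_iff [simp]:
  "interval_reversal x ` c = ivl x \<longleftrightarrow> c = ivl x"
  by (metis interval_reversal_image_image interval_reversal_image_ivl)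

lemma overlap_interval_reversal [simp]:
  "overlap (interval_reversal x ` c) (ivl x) \<longleftrightarrow> overlap c (ivl x)"
  by (metis inj_interval_reversal interval_reversal_image_ivl overlap_image)

text \<open>The dual of the Tits representation, twisted by the reversal of the interval.\<close>

definition reflect :: "nat \<times> nat \<Rightarrow> (nat set \<Rightarrow> int) \<Rightarrow> nat set \<Rightarrow> int"
  where "reflect x f c =
    (if c = ivl x then - f c
     else f (interval_reversal x ` c) + (if overlap c (ivl x) then 2 * f (ivl x) else 0))"

lemma reflect_ivl [simp]: "reflect x f (ivl x) = - f (ivl x)"
  by (simp add: reflect_def)

lemma reflect_reflect [simp]: "reflect x (reflect x f) = f"
  by (rule ext) (simp add: reflect_def)

text \<open>The common form of (j2), where \<open>y' = y\<close>, and (j3), where \<open>y'\<close>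
  is the mirror image of \<open>y\<close> in \<open>x\<close>. Since \<open>x\<close> and
  \<open>y\<close> do not overlap, neither reflection adds its term to the entry at the other
  interval, so only the reversals have to be exchanged.\<close>

lemma reflect_exchange:
  assumes Y': "interval_reversal x ` ivl y = ivl y'"
    and yX: "interval_reversal y ` ivl x = ivl x" and y'X: "interval_reversal y' ` ivl x = ivl x"
    and comm: "\<And>i. interval_reversal x (interval_reversal y i)
                 = interval_reversal y' (interval_reversal x i)"
    and ov: "\<not> overlap (ivl x) (ivl y)" and ne: "ivl x \<noteq> ivl y"
  shows "reflect x (reflect y f) = reflect y' (reflect x f)"
proof
  fix c
  have xY': "interval_reversal x ` ivl y' = ivl y"
    using Y' by (metis interval_reversal_image_image)
  have ne': "ivl x \<noteq> ivl y'"
    using Y' ne by (metis interval_reversal_image_eq_ivl_iff)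
  have ov': "\<not> overlap (ivl x) (ivl y')" "\<not> overlap (ivl y') (ivl x)" "\<not> overlap (ivl y) (ivl x)"
    using Y' ov by (metis overlap_interval_reversal overlap_sym)+
  consider "c = ivl x" | "c = ivl y'" | "c \<noteq> ivl x" "c \<noteq> ivl y'" by blast
  then show "reflect x (reflect y f) c = reflect y' (reflect x f) c"
  proof cases
    case 1
    then show ?thesis using ne ne' ov ov' yX y'X by (simp add: reflect_def)
  next
    case 2
    then show ?thesis using ne ne' ov ov' xY' by (simp add: reflect_def)
  next
    case 3
    \<comment> \<open>Both sides expand to the value of \<open>f\<close> at the twice reversed
      \<open>c\<close>, plus \<open>2 * f (ivl x)\<close> if \<open>c\<close> overlaps
      \<open>ivl x\<close>, plus \<open>2 * f (ivl y)\<close> if \<open>c\<close> overlaps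
      \<open>ivl y'\<close>. The following facts match these three summands.\<close>
    have 1: "interval_reversal y ` interval_reversal x ` c
        = interval_reversal x ` interval_reversal y' ` c"
    proof -
      have "interval_reversal y (interval_reversal x i) = interval_reversal x (interval_reversal y' i)"
        for i by (metis comm interval_reversal_involutive)
      then show ?thesis by (simp add: image_image)
    qed
    have 2: "interval_reversal x ` c \<noteq> ivl y"
      using 3 Y' by (metis interval_reversal_image_image)
    have 3: "interval_reversal y' ` c \<noteq> ivl x"
      using \<open>c \<noteq> ivl x\<close> y'X by (metis interval_reversal_image_image)
    have 4: "overlap (interval_reversal x ` c) (ivl y) = overlap c (ivl y')"
      by (metis inj_interval_reversal overlap_image xY')
    have 5: "overlap (interval_reversal y' ` c) (ivl x) = overlap c (ivl x)"
      by (metis inj_interval_reversal overlap_image y'X)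
    show ?thesis
      using \<open>c \<noteq> ivl x\<close> \<open>c \<noteq> ivl y'\<close> 1 2 3 4 5 ne ne' ov ov' xY' yX y'X
      by (simp add: reflect_def)
  qed
qed

text \<open>For overlapping \<open>c\<close> and \<open>d\<close> the sum \<open>f c + f d\<close>
  is the pairing with the isotropic vector fixed by the infinite dihedral group of the two
  reflections, so up to the twist it does not change under them. Its positivity keeps two
  overlapping sets from being negative together.\<close>

definition admissible :: "(nat set \<Rightarrow> int) \<Rightarrow> bool"
  where "admissible f \<longleftrightarrow> (\<forall>c. f c \<noteq> 0) \<and> (\<forall>c d. overlap c d \<longrightarrow> f c + f d > 0)"

lemma reflect_overlap_pos:
  assumes "admissible f" "f (ivl x) > 0" "overlap c (ivl x)"
  shows "reflect x f c > 0"
proof -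
  have "f (interval_reversal x ` c) + f (ivl x) > 0"
    using assms overlap_interval_reversal by (simp add: admissible_def)
  then show ?thesis using assms by (auto simp: reflect_def)
qed

lemma reflect_not_overlap:
  "c \<noteq> ivl x \<Longrightarrow> \<not> overlap c (ivl x) \<Longrightarrow> reflect x f c = f (interval_reversal x ` c)"
  by (simp add: reflect_def)

lemma admissible_reflect:
  assumes adm: "admissible f" and pos: "f (ivl x) > 0"
  shows "admissible (reflect x f)"
  unfolding admissible_def
proof (intro conjI allI impI)
  fix c show "reflect x f c \<noteq> 0"
    using reflect_overlap_pos[OF assms, of c] reflect_not_overlap[of c x f] adm
    by (cases "c = ivl x"; cases "overlap c (ivl x)") (auto simp: admissible_def)
next
  \<comment> \<open>At \<open>ivl x\<close> the sign flips, at \<open>d\<close> the term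
    \<open>2 * f (ivl x)\<close> is added, so the sum is the old one for the reversed
    \<open>d\<close>. Pairs avoiding \<open>ivl x\<close> only gain nonnegative terms.\<close>
  have *: "reflect x f (ivl x) + reflect x f d > 0" if "overlap d (ivl x)" for d
  proof -
    have "f (interval_reversal x ` d) + f (ivl x) > 0"
      using adm that by (simp add: admissible_def)
    then show ?thesis using that by (auto simp: reflect_def)
  qed
  fix c d assume ov: "overlap c d"
  consider "c = ivl x" | "d = ivl x" | "c \<noteq> ivl x" "d \<noteq> ivl x" by blast
  then show "reflect x f c + reflect x f d > 0"
  proof cases
    case 1 then show ?thesis using * ov overlap_sym by blast
  next
    case 2 then show ?thesis using * ov by (simp add: add.commute)
  next
    case 3
    have "overlap (interval_reversal x ` c) (interval_reversal x ` d)"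
      using ov inj_interval_reversal overlap_image by blast
    then have "f (interval_reversal x ` c) + f (interval_reversal x ` d) > 0"
      using adm by (simp add: admissible_def)
    then show ?thesis using 3 pos by (simp add: reflect_def)
  qed
qed

text \<open>A letter that overlaps the only descent replaces it. Any other negative entry
  \<open>c\<close> would not overlap \<open>ivl x\<close> and hence would be carried by the reversal
  to \<open>d\<close>, which does overlap it.\<close>

lemma reflect_single_neg:
  assumes "admissible f" "\<And>c. f c < 0 \<Longrightarrow> c = d" "overlap d (ivl x)"
  shows "reflect x f c < 0 \<longleftrightarrow> c = ivl x"
proof -
  have pos: "f (ivl x) > 0"
    using assms by (metis admissible_def linorder_neqE_linordered_idom overlap_irrefl)
  have "c = ivl x" if "reflect x f c < 0"
  proof (rule ccontr)
    assume "c \<noteq> ivl x"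
    moreover have "\<not> overlap c (ivl x)"
      using reflect_overlap_pos[OF assms(1) pos] that by force
    ultimately have "interval_reversal x ` c = d"
      using that assms(2) reflect_not_overlap by metis
    then show False using assms(3) \<open>\<not> overlap c (ivl x)\<close> by auto
  qed
  then show ?thesis using pos by auto
qed

text \<open>Negative entries mark the left descents of the element represented by the word.\<close>

definition chamber :: "(nat \<times> nat) list \<Rightarrow> nat set \<Rightarrow> int"
  where "chamber us = foldr reflect us (\<lambda>_. 1)"

lemma chamber_Nil [simp]: "chamber [] c = 1"
  by (simp add: chamber_def)

lemma chamber_Cons [simp]: "chamber (x # us) = reflect x (chamber us)"
  by (simp add: chamber_def)

section \<open>The word problem\<close>

text \<open>Words without inverse letters suffice because the generators are involutions; the
  inverse of an element is then given by the reversed word.\<close>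

definition cactus_eq :: "nat \<Rightarrow> (nat \<times> nat) list \<Rightarrow> (nat \<times> nat) list \<Rightarrow> bool"
  where "cactus_eq n us vs \<longleftrightarrow> pres_eq (cactus_gens n) (cactus_rels n)
    (map (\<lambda>x. (x, True)) us) (map (\<lambda>x. (x, True)) vs)"

lemma map_True_words [simp]: "map (\<lambda>x. (x, True)) us \<in> words X \<longleftrightarrow> us \<in> lists X"
  by (induction us) auto

lemma rev_in_lists [simp]: "rev us \<in> lists X \<longleftrightarrow> us \<in> lists X"
  by (simp add: in_lists_conv_set)

lemma cactus_gens_ivl_inj:
  "x \<in> cactus_gens n \<Longrightarrow> y \<in> cactus_gens n \<Longrightarrow> ivl x = ivl y \<longleftrightarrow> x = y"
  by (cases x; cases y) (auto simp: cactus_gens_def Icc_eq_Icc)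

text \<open>The reflections satisfy the defining relations, so they give an action of the group.
  Both signs of a letter act alike, because a reflection is its own inverse.\<close>

lemma word_reflect_pres_eq:
  assumes "pres_eq (cactus_gens n) (cactus_rels n) u v"
  shows "foldr (\<lambda>l. reflect (fst l)) u f = foldr (\<lambda>l. reflect (fst l)) v f"
  using assms
proof (induction arbitrary: f rule: pres_eq.induct)
  case (pres_eq_rel u v l r)
  have "foldr (\<lambda>l. reflect (fst l)) l f = foldr (\<lambda>l. reflect (fst l)) r f" for f
    using pres_eq_rel(3) unfolding cactus_rels_def
  proof (elim UnE CollectE exE conjE)
    fix p q m r' assume 1: "(l, r) = ([sgen p q, sgen m r'], [sgen m r', sgen p q])"
      "{p..q} \<inter> {m..r'} = {}" "(p, q) \<in> cactus_gens n" "(m, r') \<in> cactus_gens n"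
    have "reflect (p, q) (reflect (m, r') f) = reflect (m, r') (reflect (p, q) f)"
    proof (rule reflect_exchange)
      show "\<And>i. interval_reversal (p, q) (interval_reversal (m, r') i)
          = interval_reversal (m, r') (interval_reversal (p, q) i)"
        using 1(2) by (rule interval_reversal_commute)
    qed (use 1 in \<open>auto simp: overlap_def cactus_gens_def Int_commute intro!: interval_reversal_image_disjoint\<close>)
    then show ?thesis using 1 by simp
  next
    fix p q m r' assume 1: "(l, r) = ([sgen p q, sgen m r'], [sgen (p + q - r') (p + q - m), sgen p q])"
      "{m..r'} \<subseteq> {p..q}" "(p, q) \<in> cactus_gens n" "(m, r') \<in> cactus_gens n"
    have le: "p \<le> m" "m < r'" "r' \<le> q" using 1 by (auto simp: cactus_gens_def)
    have "reflect (p, q) (reflect (m, r') f)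
        = reflect (p + q - r', p + q - m) (reflect (p, q) f)"
    \<comment> \<open>The inclusion in (j3) may be an equality; then both sides are the same square,
      while \<open>reflect_exchange\<close> asks for different intervals.\<close>
    proof (cases "(p, q) = (m, r')")
      case True
      then show ?thesis by auto
    next
      case False
      show ?thesis
      proof (rule reflect_exchange)
        show "interval_reversal (p, q) ` ivl (m, r') = ivl (p + q - r', p + q - m)"
          using le interval_reversal_image_nested by simp
        show "\<And>i. interval_reversal (p, q) (interval_reversal (m, r') i)
          = interval_reversal (p + q - r', p + q - m) (interval_reversal (p, q) i)"
          using le by (rule interval_reversal_nested)
        show "ivl (p, q) \<noteq> ivl (m, r')"
          using False 1 cactus_gens_ivl_inj by blast
      qed (use le in \<open>auto simp: overlap_def intro!: interval_reversal_image_superset\<close>)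
    qed
    then show ?thesis using 1 by simp
  qed auto
  then show ?case by simp
qed auto

lemma chamber_cong: "cactus_eq n us vs \<Longrightarrow> chamber us = chamber vs"
  using word_reflect_pres_eq[of n "map (\<lambda>x. (x, True)) us" "map (\<lambda>x. (x, True)) vs" "\<lambda>_. 1"]
  by (simp add: cactus_eq_def chamber_def foldr_map comp_def)

section \<open>Computing with positive words\<close>

lemma cactus_eq_lists: "cactus_eq n us vs \<Longrightarrow> us \<in> lists (cactus_gens n) \<and> vs \<in> lists (cactus_gens n)"
  unfolding cactus_eq_def by (metis cactus_rels_words map_True_words pres_eq_words)

lemma cactus_eq_refl [simp]: "us \<in> lists (cactus_gens n) \<Longrightarrow> cactus_eq n us us"
  by (simp add: cactus_eq_def pres_eq_refl)

lemma cactus_eq_sym: "cactus_eq n us vs \<Longrightarrow> cactus_eq n vs us"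
  by (simp add: cactus_eq_def pres_eq_sym)

lemma cactus_eq_trans [trans]: "cactus_eq n us vs \<Longrightarrow> cactus_eq n vs ws \<Longrightarrow> cactus_eq n us ws"
  unfolding cactus_eq_def by (rule pres_eq_trans)

lemma cactus_eq_append:
  "cactus_eq n us us' \<Longrightarrow> cactus_eq n vs vs' \<Longrightarrow> cactus_eq n (us @ vs) (us' @ vs')"
  unfolding cactus_eq_def map_append by (rule pres_eq_append[OF cactus_rels_words])

lemma cactus_eq_Cons:
  "x \<in> cactus_gens n \<Longrightarrow> cactus_eq n us vs \<Longrightarrow> cactus_eq n (x # us) (x # vs)"
  using cactus_eq_append[of n "[x]" "[x]" us vs] by simp

lemma cactus_eq_rel:
  "(map (\<lambda>x. (x, True)) us, map (\<lambda>x. (x, True)) vs) \<in> cactus_rels n \<Longrightarrow> cactus_eq n us vs"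
  unfolding cactus_eq_def using pres_eq_rel[of "[]" "cactus_gens n" "[]"] by fastforce

lemma cactus_eq_square: "x \<in> cactus_gens n \<Longrightarrow> cactus_eq n [x, x] []"
  by (rule cactus_eq_rel) (cases x, auto simp: cactus_rels_def)

lemma cactus_eq_square_Cons:
  assumes "x \<in> cactus_gens n" "us \<in> lists (cactus_gens n)"
  shows "cactus_eq n (x # x # us) us"
  using cactus_eq_append[OF cactus_eq_square[OF assms(1)] cactus_eq_refl[OF assms(2)]] by simp

lemma cactus_eq_rev_append:
  "us \<in> lists (cactus_gens n) \<Longrightarrow> cactus_eq n (rev us @ us) []"
proof (induction us)
  case (Cons x us)
  have "cactus_eq n (rev us @ x # x # us) (rev us @ us)"
    using Cons by (intro cactus_eq_append cactus_eq_square_Cons cactus_eq_refl) auto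
  also have "cactus_eq n (rev us @ us) []" using Cons by simp
  finally show ?case by simp
qed simp

lemma cactus_eq_append_rev:
  "us \<in> lists (cactus_gens n) \<Longrightarrow> cactus_eq n (us @ rev us) []"
  using cactus_eq_rev_append[of "rev us" n] by simp

lemma cactus_eq_rev:
  assumes "cactus_eq n us vs"
  shows "cactus_eq n (rev us) (rev vs)"
proof -
  have l: "us \<in> lists (cactus_gens n)" "vs \<in> lists (cactus_gens n)"
    using cactus_eq_lists[OF assms] by auto
  have "cactus_eq n (rev us @ []) (rev us @ (vs @ rev vs))"
    using l by (intro cactus_eq_append cactus_eq_refl cactus_eq_sym[OF cactus_eq_append_rev]) auto
  also have "cactus_eq n (rev us @ (vs @ rev vs)) (rev us @ (us @ rev vs))"
    using l assms by (intro cactus_eq_append cactus_eq_refl cactus_eq_sym[OF assms]) auto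
  also have "cactus_eq n (rev us @ (us @ rev vs)) ([] @ rev vs)"
    unfolding append_assoc[symmetric]
    using l by (intro cactus_eq_append cactus_eq_refl cactus_eq_rev_append) auto
  finally show ?thesis by simp
qed

text \<open>Brings the second letter to the front. Nested letters are exchanged by (j3), read
  forwards if \<open>x\<close> contains \<open>y\<close> and backwards if \<open>y\<close> contains
  \<open>x\<close>.\<close>

lemma cactus_eq_swap:
  assumes x: "x \<in> cactus_gens n" and y: "y \<in> cactus_gens n"
    and ov: "\<not> overlap (ivl x) (ivl y)"
  shows "\<exists>x'\<in>cactus_gens n. \<exists>y'\<in>cactus_gens n.
    ivl y' = interval_reversal x ` ivl y \<and> cactus_eq n [x, y] [y', x']"
proof -
  obtain p q m r where xy: "x = (p, q)" "y = (m, r)" by (cases x; cases y)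
  consider "ivl x \<inter> ivl y = {}" | "ivl y \<subseteq> ivl x" | "ivl x \<subseteq> ivl y"
    using ov by (auto simp: overlap_def)
  then show ?thesis
  proof cases
    case 1
    then have "cactus_eq n [x, y] [y, x]"
      using x y xy by (intro cactus_eq_rel) (auto simp: cactus_rels_def)
    moreover have "interval_reversal x ` ivl y = ivl y"
      using 1 by (simp add: Int_commute interval_reversal_image_disjoint)
    ultimately show ?thesis using x y by metis
  next
    case 2
    then have le: "p \<le> m" "m < r" "r \<le> q" using x y xy by (auto simp: cactus_gens_def)
    have "cactus_eq n [x, y] [(p + q - r, p + q - m), x]"
      using x y xy 2 by (intro cactus_eq_rel) (auto simp: cactus_rels_def)
    moreover have "interval_reversal x ` ivl y = ivl (p + q - r, p + q - m)"
      using le xy interval_reversal_image_nested by simp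
    moreover have "(p + q - r, p + q - m) \<in> cactus_gens n"
      using le x xy by (auto simp: cactus_gens_def)
    ultimately show ?thesis using x by metis
  next
    case 3
    then have le: "m \<le> p" "p < q" "q \<le> r" using x y xy by (auto simp: cactus_gens_def)
    \<comment> \<open>The mirror image of \<open>x\<close> in \<open>y\<close>. Mirroring it again
      returns \<open>x\<close>, so (j3) turns the word \<open>[y, ?x']\<close> into
      \<open>[x, y]\<close>.\<close>
    let ?x' = "(m + r - q, m + r - p)"
    have x': "?x' \<in> cactus_gens n"
      using le y xy by (auto simp: cactus_gens_def)
    have "(m + r - (m + r - p), m + r - (m + r - q)) = (p, q)"
      using le by simp
    moreover have "{m + r - q..m + r - p} \<subseteq> {m..r}" using le by auto
    ultimately have "cactus_eq n [y, ?x'] [x, y]"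
      using x' x y xy unfolding xy
      by (intro cactus_eq_rel) (unfold cactus_rels_def, force)
    then have "cactus_eq n [x, y] [y, ?x']" by (rule cactus_eq_sym)
    moreover have "interval_reversal x ` ivl y = ivl y"
      using 3 by (rule interval_reversal_image_superset)
    ultimately show ?thesis using y x' by metis
  qed
qed

text \<open>A negative entry at an interval lets the word be rewritten so that it starts with that
  letter and does not get longer. Admissibility belongs to the same induction:
  \<open>admissible_reflect\<close> needs a positive entry at the new letter, and a negative one is
  removed by shortening the word.\<close>

lemma chamber_admissible_descent:
  assumes "us \<in> lists (cactus_gens n)"
  shows "admissible (chamber us) \<and> (\<forall>c. chamber us c < 0 \<longrightarrow>
    (\<exists>x\<in>cactus_gens n. c = ivl x \<and> (\<exists>vs. length vs < length us \<and> cactus_eq n us (x # vs))))"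
  using assms
proof (induction "length us" arbitrary: us rule: less_induct)
  case less
  show ?case
  proof (cases us)
    case Nil
    then show ?thesis by (simp add: admissible_def)
  next
    case (Cons x v)
    have x: "x \<in> cactus_gens n" and v: "v \<in> lists (cactus_gens n)"
      using less.prems Cons by auto
    have adm: "admissible (chamber v)"
      and desc: "\<And>c. chamber v c < 0 \<Longrightarrow> \<exists>y\<in>cactus_gens n. c = ivl y \<and>
        (\<exists>vs. length vs < length v \<and> cactus_eq n v (y # vs))"
      using less.hyps[of v] v Cons by auto
    show ?thesis
    proof (cases "chamber v (ivl x) < 0")
      \<comment> \<open>The rest \<open>v\<close> can be rewritten to start with \<open>x\<close>,
        which cancels against the first letter. So \<open>us\<close> equals the shorter word
        \<open>vs\<close>, and both claims are inherited from it.\<close>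
      case True
      then obtain y vs where y: "y \<in> cactus_gens n" "ivl x = ivl y" "length vs < length v"
        "cactus_eq n v (y # vs)" using desc by blast
      then have "cactus_eq n us (x # x # vs)"
        using x Cons cactus_gens_ivl_inj by (metis cactus_eq_Cons)
      moreover have vs: "vs \<in> lists (cactus_gens n)"
        using cactus_eq_lists[OF y(4)] by simp
      ultimately have eq: "cactus_eq n us vs"
        using x cactus_eq_square_Cons cactus_eq_trans by blast
      have IH: "admissible (chamber vs) \<and> (\<forall>c. chamber vs c < 0 \<longrightarrow>
        (\<exists>x\<in>cactus_gens n. c = ivl x \<and> (\<exists>ws. length ws < length vs \<and> cactus_eq n vs (x # ws))))"
        using less.hyps[of vs] vs y(3) Cons by simp
      show ?thesis
      proof (intro conjI allI impI)
        show "admissible (chamber us)"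
          using IH chamber_cong[OF eq] by simp
        fix c assume "chamber us c < 0"
        then obtain z ws where "z \<in> cactus_gens n" "c = ivl z" "length ws < length vs"
          "cactus_eq n vs (z # ws)" using IH chamber_cong[OF eq] by metis
        moreover from this have "cactus_eq n us (z # ws)" using eq cactus_eq_trans by blast
        moreover have "length ws < length us" using calculation(3) y(3) Cons by simp
        ultimately show "\<exists>x\<in>cactus_gens n. c = ivl x \<and>
          (\<exists>vs. length vs < length us \<and> cactus_eq n us (x # vs))" by blast
      qed
    next
      case False
      then have pos: "chamber v (ivl x) > 0"
        using adm by (metis admissible_def linorder_neqE_linordered_idom)
      show ?thesis
      proof (intro conjI allI impI)
        show "admissible (chamber us)"
          using admissible_reflect[OF adm pos] Cons by simp
        fix c assume neg: "chamber us c < 0"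
        show "\<exists>x\<in>cactus_gens n. c = ivl x \<and>
          (\<exists>vs. length vs < length us \<and> cactus_eq n us (x # vs))"
        proof (cases "c = ivl x")
          case True
          then show ?thesis using x less.prems Cons by (metis cactus_eq_refl length_Cons lessI)
        next
          case ne: False
          \<comment> \<open>A negative entry away from \<open>ivl x\<close> comes from the reversed
            set, which is negative for \<open>v\<close>. Its letter is moved to the front of
            \<open>v\<close> by induction and then past \<open>x\<close> by
            \<open>cactus_eq_swap\<close>.\<close>
          have ov: "\<not> overlap c (ivl x)"
            using neg reflect_overlap_pos[OF adm pos, of c] Cons by auto
          then have "chamber v (interval_reversal x ` c) < 0"
            using neg Cons ne by (simp add: reflect_not_overlap)
          then obtain y vs where y: "y \<in> cactus_gens n" "interval_reversal x ` c = ivl y"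
            "length vs < length v" "cactus_eq n v (y # vs)" using desc by blast
          have "\<not> overlap (ivl x) (ivl y)"
            using ov y(2) overlap_interval_reversal overlap_sym by metis
          then obtain x' y' where s: "x' \<in> cactus_gens n" "y' \<in> cactus_gens n"
            "ivl y' = interval_reversal x ` ivl y" "cactus_eq n [x, y] [y', x']"
            using cactus_eq_swap[OF x y(1)] by blast
          have vs: "vs \<in> lists (cactus_gens n)" using cactus_eq_lists[OF y(4)] by simp
          have "cactus_eq n us (x # y # vs)"
            using Cons x y(4) cactus_eq_Cons by simp
          also have "cactus_eq n (x # y # vs) (y' # x' # vs)"
            using cactus_eq_append[OF s(4) cactus_eq_refl[OF vs]] by simp
          finally have "cactus_eq n us (y' # x' # vs)" .
          moreover have "c = ivl y'" using s(3) y(2) interval_reversal_image_image by metis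
          moreover have "length (x' # vs) < length us" using y(3) Cons by simp
          ultimately show ?thesis using s(2) by blast
        qed
      qed
    qed
  qed
qed

lemma chamber_admissible: "us \<in> lists (cactus_gens n) \<Longrightarrow> admissible (chamber us)"
  using chamber_admissible_descent by blast

lemma chamber_not_neg: "us \<in> lists (cactus_gens n) \<Longrightarrow> \<not> chamber us c < 0 \<longleftrightarrow> chamber us c > 0"
  using chamber_admissible unfolding admissible_def by (metis less_asym linorder_neqE_linordered_idom)

lemma chamber_neg_ivl:
  "us \<in> lists (cactus_gens n) \<Longrightarrow> chamber us c < 0 \<Longrightarrow> \<exists>x\<in>cactus_gens n. c = ivl x"
  using chamber_admissible_descent by blast

section \<open>Length and descents\<close>

definition cactus_len :: "nat \<Rightarrow> (nat \<times> nat) list \<Rightarrow> nat"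
  where "cactus_len n us = (LEAST k. \<exists>vs. cactus_eq n us vs \<and> length vs = k)"

lemma cactus_len_le: "cactus_eq n us vs \<Longrightarrow> cactus_len n us \<le> length vs"
  unfolding cactus_len_def by (rule Least_le) blast

lemma cactus_len_attained:
  assumes "us \<in> lists (cactus_gens n)"
  obtains vs where "cactus_eq n us vs" "length vs = cactus_len n us"
proof -
  have "\<exists>k. \<exists>vs. cactus_eq n us vs \<and> length vs = k" using assms cactus_eq_refl by blast
  then have "\<exists>vs. cactus_eq n us vs \<and> length vs = cactus_len n us"
    unfolding cactus_len_def by (rule LeastI_ex)
  then show ?thesis using that by blast
qed

lemma cactus_len_cong: "cactus_eq n us vs \<Longrightarrow> cactus_len n us = cactus_len n vs"
  by (metis cactus_eq_lists cactus_eq_sym cactus_eq_trans cactus_len_attained cactus_len_le le_antisym)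

lemma cactus_len_append:
  assumes "us \<in> lists (cactus_gens n)" "vs \<in> lists (cactus_gens n)"
  shows "cactus_len n (us @ vs) \<le> cactus_len n us + cactus_len n vs"
proof -
  obtain us' where u: "cactus_eq n us us'" "length us' = cactus_len n us"
    using assms(1) by (rule cactus_len_attained)
  obtain vs' where v: "cactus_eq n vs vs'" "length vs' = cactus_len n vs"
    using assms(2) by (rule cactus_len_attained)
  show ?thesis using cactus_len_le[OF cactus_eq_append[OF u(1) v(1)]] u v by simp
qed

lemma cactus_len_Cons_le:
  "x \<in> cactus_gens n \<Longrightarrow> us \<in> lists (cactus_gens n) \<Longrightarrow> cactus_len n (x # us) \<le> Suc (cactus_len n us)"
  using cactus_len_append[of "[x]" n us] cactus_len_le[of n "[x]" "[x]"] by simp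

lemma cactus_len_rev:
  assumes "us \<in> lists (cactus_gens n)"
  shows "cactus_len n (rev us) = cactus_len n us"
proof -
  have *: "cactus_len n (rev us) \<le> cactus_len n us" if "us \<in> lists (cactus_gens n)" for us
    using that by (metis cactus_eq_rev cactus_len_attained cactus_len_le length_rev)
  show ?thesis using *[of us] *[of "rev us"] assms by simp
qed

text \<open>If the entry is negative, a shortest word can be rewritten to start with
  \<open>x\<close>, which cancels. If it is positive, the same argument applies to
  \<open>x # us\<close>, where the sign is flipped.\<close>

lemma chamber_neg_iff:
  assumes x: "x \<in> cactus_gens n" and us: "us \<in> lists (cactus_gens n)"
  shows "chamber us (ivl x) < 0 \<longleftrightarrow> cactus_len n (x # us) < cactus_len n us"
proof -
  have *: "cactus_len n (x # us) < cactus_len n us"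
    if us: "us \<in> lists (cactus_gens n)" and neg: "chamber us (ivl x) < 0" for us
  proof -
    obtain vs where v: "cactus_eq n us vs" "length vs = cactus_len n us"
      using us by (rule cactus_len_attained)
    have "vs \<in> lists (cactus_gens n)" using cactus_eq_lists[OF v(1)] by simp
    moreover have "chamber vs (ivl x) < 0" using neg chamber_cong[OF v(1)] by simp
    ultimately obtain y ws where y: "y \<in> cactus_gens n" "ivl x = ivl y"
      "length ws < length vs" "cactus_eq n vs (y # ws)"
      using chamber_admissible_descent by metis
    have "y = x" using x y cactus_gens_ivl_inj by blast
    have ws: "ws \<in> lists (cactus_gens n)" using cactus_eq_lists[OF y(4)] by simp
    have "cactus_eq n (x # us) (x # x # ws)"
      using x v(1) y(4) \<open>y = x\<close> by (metis cactus_eq_Cons cactus_eq_trans)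
    also have "cactus_eq n (x # x # ws) ws" using x ws by (rule cactus_eq_square_Cons)
    finally show ?thesis using cactus_len_le y(3) v(2) by fastforce
  qed
  have "cactus_len n us < cactus_len n (x # us)" if "chamber us (ivl x) > 0"
    using *[of "x # us"] that us x cactus_len_cong[OF cactus_eq_square_Cons[OF x us]] by simp
  then show ?thesis using *[OF us] chamber_not_neg[OF us, of "ivl x"] by fastforce
qed

text \<open>The first letter of a nonempty shortest word is a descent.\<close>

lemma cactus_eq_NilI:
  assumes us: "us \<in> lists (cactus_gens n)"
    and pos: "\<And>x. x \<in> cactus_gens n \<Longrightarrow> \<not> chamber us (ivl x) < 0"
  shows "cactus_eq n us []"
proof -
  obtain vs where v: "cactus_eq n us vs" "length vs = cactus_len n us"
    using us by (rule cactus_len_attained)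
  show ?thesis
  proof (cases vs)
    case (Cons x ws)
    have l: "x \<in> cactus_gens n" "ws \<in> lists (cactus_gens n)"
      using cactus_eq_lists[OF v(1)] Cons by auto
    have "cactus_eq n (x # us) (x # x # ws)" using l v(1) Cons cactus_eq_Cons by blast
    also have "cactus_eq n (x # x # ws) ws" using l by (rule cactus_eq_square_Cons)
    finally have "cactus_len n (x # us) \<le> length ws" by (rule cactus_len_le)
    then show ?thesis using pos[OF l(1)] chamber_neg_iff[OF l(1) us] v(2) Cons by simp
  qed (use v in simp)
qed

text \<open>By induction, the last letter \<open>x\<close> of a shortest word for \<open>us\<close>
  is moved over to \<open>vs\<close>. It is a descent of the inverse of \<open>us\<close>, hence not
  of \<open>vs\<close>, so what one factor loses in length the other gains.\<close>

lemma cactus_len_append_eq: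
  assumes "us \<in> lists (cactus_gens n)" "vs \<in> lists (cactus_gens n)"
    and "\<And>c. \<not> (chamber (rev us) c < 0 \<and> chamber vs c < 0)"
  shows "cactus_len n (us @ vs) = cactus_len n us + cactus_len n vs"
  using assms
proof (induction "cactus_len n us" arbitrary: us vs)
  case 0
  then have "cactus_eq n us []"
    by (metis cactus_len_attained length_0_conv)
  then have "cactus_eq n (us @ vs) ([] @ vs)"
    using 0 by (intro cactus_eq_append cactus_eq_refl)
  then show ?case using cactus_len_cong 0 by fastforce
next
  case (Suc k)
  obtain us' where u: "cactus_eq n us us'" "length us' = cactus_len n us"
    using Suc.prems(1) by (rule cactus_len_attained)
  then obtain v x where vx: "us' = v @ [x]" using Suc.hyps(2)
    by (metis length_0_conv nat.distinct(1) rev_exhaust)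
  have x: "x \<in> cactus_gens n" and v: "v \<in> lists (cactus_gens n)"
    using cactus_eq_lists[OF u(1)] vx by auto
  have rv: "rev v \<in> lists (cactus_gens n)" using v by simp
  have rev_eq: "cactus_eq n (rev us) (x # rev v)" using cactus_eq_rev[OF u(1)] vx by simp
  have le: "cactus_len n v \<le> k" using cactus_len_le[of n v v] v u(2) vx Suc.hyps(2) by simp
  have len_us: "cactus_len n us = cactus_len n (x # rev v)"
    using cactus_len_cong[OF rev_eq] cactus_len_rev Suc.prems(1) by simp
  then have len_v: "cactus_len n v = k"
    using le cactus_len_Cons_le[OF x rv] cactus_len_rev[OF v] Suc.hyps(2) by simp
  have ch: "chamber (rev us) = reflect x (chamber (rev v))"
    using chamber_cong[OF rev_eq] by simp
  have pos_v: "chamber (rev v) (ivl x) > 0"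
    using chamber_neg_iff[OF x rv] chamber_not_neg[OF rv] len_v len_us Suc.hyps(2)
      cactus_len_rev[OF v] by fastforce
  then have "chamber (rev us) (ivl x) < 0" using ch by simp
  then have pos_vs: "chamber vs (ivl x) > 0"
    using Suc.prems(3) chamber_not_neg[OF Suc.prems(2)] by blast
  have "cactus_len n vs < cactus_len n (x # vs)"
    using chamber_neg_iff[OF x, of "x # vs"] pos_vs x Suc.prems(2)
      cactus_len_cong[OF cactus_eq_square_Cons[OF x Suc.prems(2)]] by simp
  then have len_xvs: "cactus_len n (x # vs) = Suc (cactus_len n vs)"
    using cactus_len_Cons_le[OF x Suc.prems(2)] by simp
  \<comment> \<open>A common descent \<open>c\<close> of \<open>rev v\<close> and
    \<open>x # vs\<close> neither equals nor overlaps \<open>ivl x\<close>, so the reversal carries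
    it to a common descent of \<open>rev us\<close> and \<open>vs\<close>.\<close>
  have disj: "\<not> (chamber (rev v) c < 0 \<and> chamber (x # vs) c < 0)" for c
  proof
    assume neg: "chamber (rev v) c < 0 \<and> chamber (x # vs) c < 0"
    then have "c \<noteq> ivl x" using pos_v by auto
    moreover have "\<not> overlap c (ivl x)"
      using neg reflect_overlap_pos[OF chamber_admissible[OF Suc.prems(2)] pos_vs, of c] by auto
    ultimately have "chamber vs (interval_reversal x ` c) < 0"
      "chamber (rev us) (interval_reversal x ` c) < 0"
      using neg by (simp_all add: ch reflect_not_overlap)
    then show False using Suc.prems(3) by blast
  qed
  have "cactus_eq n (us @ vs) ((v @ [x]) @ vs)"
    using u(1) vx Suc.prems(2) by (intro cactus_eq_append cactus_eq_refl) auto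
  then have "cactus_len n (us @ vs) = cactus_len n (v @ x # vs)"
    using cactus_len_cong by fastforce
  also have "\<dots> = cactus_len n v + cactus_len n (x # vs)"
    using Suc.hyps(1)[of v "x # vs"] len_v v x Suc.prems(2) disj by simp
  finally show ?case using len_v len_xvs Suc.hyps(2) by simp
qed

section \<open>Centralizing elements\<close>

text \<open>Lengths add in \<open>us @ x # h\<close>, hence also in the equal product
  \<open>x # h @ us\<close>. There \<open>x\<close> is a descent, so no descent of the product
  overlaps \<open>ivl x\<close>; but \<open>c\<close> is one.\<close>

lemma commuting_descent_contradiction:
  assumes us: "us \<in> lists (cactus_gens n)" and h: "x # h \<in> lists (cactus_gens n)"
    and comm: "cactus_eq n (us @ x # h) (x # h @ us)"
    and disj: "\<And>c. \<not> (chamber (rev us) c < 0 \<and> chamber (x # h) c < 0)"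
    and desc: "chamber (x # h) (ivl x) < 0"
    and neg: "chamber (us @ x # h) c < 0" and ov: "overlap c (ivl x)"
  shows False
proof -
  have x: "x \<in> cactus_gens n" and h': "h \<in> lists (cactus_gens n)" and hu: "h @ us \<in> lists (cactus_gens n)"
    using us h by auto
  have "cactus_len n h < cactus_len n (x # h)"
    using chamber_neg_iff[OF x h] desc cactus_len_cong[OF cactus_eq_square_Cons[OF x h']] by simp
  then have "cactus_len n (h @ us) < cactus_len n (x # h) + cactus_len n us"
    using cactus_len_append[OF h' us] by simp
  also have "\<dots> = cactus_len n (x # h @ us)"
    using cactus_len_append_eq[OF us h disj] cactus_len_cong[OF comm] by simp
  finally have "chamber (h @ us) (ivl x) > 0"
    using chamber_neg_iff[OF x hu] chamber_not_neg[OF hu] by fastforce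
  then have "chamber (x # h @ us) c > 0"
    using reflect_overlap_pos[OF chamber_admissible[OF hu] _ ov] by simp
  then show False using neg chamber_cong[OF comm] by simp
qed

section \<open>Powers of a product of two generators\<close>

definition alternating :: "nat \<Rightarrow> nat \<times> nat \<Rightarrow> nat \<times> nat \<Rightarrow> (nat \<times> nat) list"
  where "alternating k x y = concat (replicate k [x, y])"

lemma alternating_Suc [simp]: "alternating (Suc k) x y = x # y # alternating k x y"
  by (simp add: alternating_def)

lemma alternating_lists:
  "x \<in> X \<Longrightarrow> y \<in> X \<Longrightarrow> alternating k x y \<in> lists X"
  by (induction k) (auto simp: alternating_def)

text \<open>Each letter overlaps the only descent of the word behind it and so becomes the only
  descent itself. The exponent is \<open>Suc k\<close> because the empty word has no
  descent.\<close>

lemma chamber_alternating: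
  assumes x: "x \<in> cactus_gens n" and y: "y \<in> cactus_gens n" and ov: "overlap (ivl x) (ivl y)"
  shows "chamber (alternating (Suc k) x y) c < 0 \<longleftrightarrow> c = ivl x"
proof (induction k arbitrary: c)
  case 0
  have "chamber [y] c < 0 \<longleftrightarrow> c = ivl y" for c
    \<comment> \<open>The constant function has no negative entry, so any set overlapping
      \<open>ivl y\<close> can be taken as the exceptional one.\<close>
    using reflect_single_neg[of "chamber []" "ivl x" y] ov by (simp add: admissible_def)
  moreover have "admissible (chamber [y])" using chamber_admissible[of "[y]" n] y by simp
  ultimately have "reflect x (chamber [y]) c < 0 \<longleftrightarrow> c = ivl x"
    using overlap_sym[OF ov] by (intro reflect_single_neg[of _ "ivl y"]) auto
  then show ?case by (simp add: alternating_def)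
next
  case (Suc k)
  let ?w = "alternating (Suc k) x y"
  have w: "?w \<in> lists (cactus_gens n)" using x y by (rule alternating_lists)
  have "chamber (y # ?w) c < 0 \<longleftrightarrow> c = ivl y" for c
    using reflect_single_neg[of "chamber ?w" "ivl x" y] ov chamber_admissible[OF w] Suc by auto
  moreover have "admissible (chamber (y # ?w))" using chamber_admissible[of "y # ?w" n] y w by simp
  ultimately have "reflect x (chamber (y # ?w)) c < 0 \<longleftrightarrow> c = ivl x"
    using overlap_sym[OF ov] by (intro reflect_single_neg[of _ "ivl y"]) auto
  then show ?case by simp
qed

text \<open>Otherwise lengths add in the product of \<open>us\<close> and the alternating word. Then
  the descent \<open>a\<close> of \<open>us\<close> survives in the product, although it overlaps
  the descent \<open>x\<close> of the alternating word.\<close>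

lemma commuting_alternating_descent:
  assumes us: "us \<in> lists (cactus_gens n)"
    and x: "x \<in> cactus_gens n" and a: "a \<in> cactus_gens n" and ov: "overlap (ivl a) (ivl x)"
    and comm: "cactus_eq n (us @ alternating (Suc k) x a) (alternating (Suc k) x a @ us)"
    and neg: "chamber us (ivl a) < 0"
  shows "chamber (rev us) (ivl x) < 0"
proof (rule ccontr)
  assume contr: "\<not> chamber (rev us) (ivl x) < 0"
  let ?h = "a # alternating k x a"
  have h: "x # ?h \<in> lists (cactus_gens n)"
    using alternating_lists[OF x a, of "Suc k"] by simp
  have ch: "chamber (x # ?h) c < 0 \<longleftrightarrow> c = ivl x" for c
    using chamber_alternating[OF x a overlap_sym[OF ov], of k c] by simp
  have disj: "\<not> (chamber (rev us) c < 0 \<and> chamber (x # ?h) c < 0)" for c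
    using contr ch[of c] by (cases "c = ivl x") simp_all
  have "cactus_len n (a # us @ x # ?h) \<le> cactus_len n (a # us) + cactus_len n (x # ?h)"
    using cactus_len_append[of "a # us" n "x # ?h"] us a h by simp
  also have "\<dots> < cactus_len n us + cactus_len n (x # ?h)"
    using chamber_neg_iff[OF a us] neg by simp
  also have "\<dots> = cactus_len n (us @ x # ?h)"
    using cactus_len_append_eq[OF us h disj] by simp
  finally have "chamber (us @ x # ?h) (ivl a) < 0"
    using chamber_neg_iff[OF a, of "us @ x # ?h"] us h by simp
  moreover have "chamber (x # ?h) (ivl x) < 0" using ch by blast
  ultimately show False
    using commuting_descent_contradiction[OF us h _ disj _ _ ov] comm by simp
qed

section \<open>The overlap graph of intervals\<close>

lemma overlap_Icc:
  "overlap {p..q} {m..r} \<longleftrightarrow> (p < m \<and> m \<le> q \<and> q < r) \<or> (m < p \<and> p \<le> r \<and> r < q)"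
  unfolding overlap_def Int_atLeastAtMost atLeastatMost_empty_iff atLeastatMost_subset_iff
  by linarith

text \<open>In the overlap graph every proper interval lies on the closed walk \<open>a\<close>,
  \<open>b\<close>, \<open>y\<close>, \<open>z\<close>, \<open>b'\<close>, \<open>a\<close> of odd
  length five, which a bipartite graph cannot contain.\<close>

lemma overlapping_at_distance_two:
  assumes n: "n > 3" and a: "a \<in> cactus_gens n" "a \<noteq> (1, n)"
  shows "\<exists>b b' y z. {b, b', y, z} \<subseteq> cactus_gens n \<and>
    overlap (ivl a) (ivl b) \<and> overlap (ivl b) (ivl y) \<and>
    overlap (ivl a) (ivl b') \<and> overlap (ivl b') (ivl z) \<and> overlap (ivl y) (ivl z)"
proof -
  obtain p q where pq: "a = (p, q)" "1 \<le> p" "p < q" "q \<le> n"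
    using a by (cases a) (auto simp: cactus_gens_def)
  have W: ?thesis if "{b, b', y, z} \<subseteq> cactus_gens n" "overlap (ivl a) (ivl b)" "overlap (ivl b) (ivl y)"
    "overlap (ivl a) (ivl b')" "overlap (ivl b') (ivl z)" "overlap (ivl y) (ivl z)" for b b' y z
    using that by blast
  \<comment> \<open>The mirror symmetry of \<open>{1..n}\<close> exchanges the second case with the
    fourth and the third with the fifth, and the witnesses below are mirrored accordingly.\<close>
  consider "1 < p" "q < n" | "p = 1" "q < n - 1" | "p = 1" "q = n - 1"
    | "p > 2" "q = n" | "p = 2" "q = n"
    using pq a(2) by fastforce
  then show ?thesis
  proof cases
    case 1
    then show ?thesis using n pq
      by (intro W[of "(1, p)" "(q, n)" "(2, n)" "(1, n - 1)"])
        (auto simp: cactus_gens_def overlap_Icc)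
  next
    case 2
    then show ?thesis using n pq
      by (intro W[of "(2, n)" "(2, n - 1)" "(1, n - 1)" "(n - 1, n)"])
        (auto simp: cactus_gens_def overlap_Icc)
  next
    case 3
    then show ?thesis using n pq
      by (intro W[of "(2, n)" "(3, n)" "(1, 2)" "(2, 3)"])
        (auto simp: cactus_gens_def overlap_Icc)
  next
    case 4
    then show ?thesis using n pq
      by (intro W[of "(1, n - 1)" "(2, n - 1)" "(2, n)" "(1, 2)"])
        (auto simp: cactus_gens_def overlap_Icc)
  next
    case 5
    then show ?thesis using n pq
      by (intro W[of "(1, n - 1)" "(1, n - 2)" "(n - 1, n)" "(n - 2, n - 1)"])
        (auto simp: cactus_gens_def overlap_Icc)
  qed
qed

lemma commutes_alternating_imp_trivial:
  assumes n: "n > 3" and us: "us \<in> lists (cactus_gens n)"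
    and comm: "\<And>x y. x \<in> cactus_gens n \<Longrightarrow> y \<in> cactus_gens n \<Longrightarrow>
      cactus_eq n (us @ alternating (Suc k) x y) (alternating (Suc k) x y @ us)"
  shows "cactus_eq n us []"
proof -
  have rus: "rev us \<in> lists (cactus_gens n)" using us by simp
  \<comment> \<open>The inverse commutes with the same words; multiply by \<open>rev us\<close> on
    both sides.\<close>
  have comm': "cactus_eq n (rev us @ alternating (Suc k) x y) (alternating (Suc k) x y @ rev us)"
    if x: "x \<in> cactus_gens n" and y: "y \<in> cactus_gens n" for x y
  proof -
    let ?h = "alternating (Suc k) x y"
    have h: "?h \<in> lists (cactus_gens n)" using x y by (rule alternating_lists)
    have "cactus_eq n ((rev us @ ?h) @ []) ((rev us @ ?h) @ us @ rev us)"
      using us h by (intro cactus_eq_append cactus_eq_refl cactus_eq_sym[OF cactus_eq_append_rev]) auto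
    also have "cactus_eq n ((rev us @ ?h) @ us @ rev us) (rev us @ (us @ ?h) @ rev us)"
    proof -
      have "cactus_eq n (rev us @ (?h @ us) @ rev us) (rev us @ (us @ ?h) @ rev us)"
        using us by (intro cactus_eq_append cactus_eq_refl cactus_eq_sym[OF comm[OF x y]]) auto
      then show ?thesis by simp
    qed
    also have "cactus_eq n (rev us @ (us @ ?h) @ rev us) ([] @ ?h @ rev us)"
    proof -
      have "cactus_eq n ((rev us @ us) @ ?h @ rev us) ([] @ ?h @ rev us)"
        using us h by (intro cactus_eq_append cactus_eq_refl cactus_eq_rev_append) auto
      then show ?thesis by simp
    qed
    finally show ?thesis by simp
  qed
  \<comment> \<open>The descent \<open>a\<close> of \<open>us\<close> yields the descent
    \<open>b\<close> of \<open>rev us\<close>, which in turn yields the descent \<open>y\<close> of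
    \<open>us\<close>.\<close>
  have step: "chamber us (ivl y) < 0"
    if "chamber us (ivl a) < 0" "a \<in> cactus_gens n" "b \<in> cactus_gens n" "y \<in> cactus_gens n"
      "overlap (ivl a) (ivl b)" "overlap (ivl b) (ivl y)" for a b y
    using commuting_alternating_descent[OF us that(3,2,5) comm that(1)] that(2,3,4,6)
      commuting_alternating_descent[OF rus that(4,3,6) comm'] by simp
  have only_top: "a = (1, n)" if a: "a \<in> cactus_gens n" "chamber us (ivl a) < 0" for a
  proof (rule ccontr)
    assume "a \<noteq> (1, n)"
    then obtain b b' y z where *: "{b, b', y, z} \<subseteq> cactus_gens n"
      "overlap (ivl a) (ivl b)" "overlap (ivl b) (ivl y)"
      "overlap (ivl a) (ivl b')" "overlap (ivl b') (ivl z)" "overlap (ivl y) (ivl z)"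
      using overlapping_at_distance_two[OF n a(1)] by blast
    have "chamber us (ivl y) < 0" "chamber us (ivl z) < 0"
      using step[of a b y] step[of a b' z] a * by auto
    then show False using *(6) chamber_admissible[OF us] unfolding admissible_def
      by (metis add_neg_neg less_asym)
  qed
  show ?thesis
  proof (cases "chamber us (ivl (1, n)) < 0")
    case False
    then show ?thesis using only_top us by (intro cactus_eq_NilI) metis+
  next
    case True
    let ?t = "(1, n)"
    have t: "?t \<in> cactus_gens n" using n by (simp add: cactus_gens_def)
    have not_ov: "\<not> overlap (ivl c) (ivl ?t)" if "c \<in> cactus_gens n" for c
      using that by (cases c) (auto simp: overlap_def cactus_gens_def)
    \<comment> \<open>No interval overlaps \<open>ivl ?t\<close>, so a descent of
      \<open>?t # us\<close> would be reversed into a descent of \<open>us\<close> other than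
      \<open>?t\<close>. Hence \<open>?t # us\<close> is trivial and \<open>us\<close> equals
      \<open>?t\<close>.\<close>
    have "cactus_eq n (?t # us) []"
    proof (rule cactus_eq_NilI)
      show "?t # us \<in> lists (cactus_gens n)" using t us by simp
      fix c assume c: "c \<in> cactus_gens n"
      show "\<not> chamber (?t # us) (ivl c) < 0"
      proof
        assume neg: "chamber (?t # us) (ivl c) < 0"
        then have "ivl c \<noteq> ivl ?t" using True by (metis chamber_Cons neg_less_0_iff_less not_less_iff_gr_or_eq reflect_ivl)
        then have *: "chamber us (interval_reversal ?t ` ivl c) < 0"
          using neg not_ov[OF c] by (simp add: reflect_not_overlap del: ivl_simp)
        then obtain d where "d \<in> cactus_gens n" "interval_reversal ?t ` ivl c = ivl d"
          using chamber_neg_ivl[OF us] by blast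
        then have "interval_reversal ?t ` ivl c = ivl ?t" using only_top * by metis
        then show False using \<open>ivl c \<noteq> ivl ?t\<close> interval_reversal_image_eq_ivl_iff by blast
      qed
    qed
    then have "cactus_eq n (?t # ?t # us) [?t]" using t by (intro cactus_eq_Cons)
    then have us_t: "cactus_eq n us [?t]"
      using cactus_eq_square_Cons[OF t us] cactus_eq_sym cactus_eq_trans by blast
    \<comment> \<open>Two overlapping intervals exchanged by the reversal of \<open>?t\<close>.
      Multiplying the alternating word by \<open>?t\<close> on the left turns its descent
      \<open>?x\<close> into \<open>?y\<close>, whereas multiplying on the right would have to keep
      \<open>?x\<close>.\<close>
    let ?x = "(1, n - 1)" and ?y = "(2, n)"
    let ?h = "?y # alternating k ?x ?y"
    have x: "?x \<in> cactus_gens n" and y: "?y \<in> cactus_gens n" and ov: "overlap (ivl ?x) (ivl ?y)"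
      using n by (auto simp: cactus_gens_def overlap_Icc)
    have h: "?x # ?h \<in> lists (cactus_gens n)"
      using alternating_lists[OF x y, of "Suc k"] by simp
    have ch: "chamber (?x # ?h) c < 0 \<longleftrightarrow> c = ivl ?x" for c
      using chamber_alternating[OF x y ov, of k c] by simp
    have rev_us: "chamber (rev us) = chamber us"
      using chamber_cong[OF cactus_eq_rev[OF us_t]] chamber_cong[OF us_t] by simp
    have disj: "\<not> (chamber (rev us) c < 0 \<and> chamber (?x # ?h) c < 0)" for c
      using only_top[OF x] ch[of c] rev_us n by (cases "c = ivl ?x") auto
    have refl_y: "interval_reversal ?t ` ivl ?y = ivl ?x"
      using n interval_reversal_image_nested[of 1 2 n n] by simp
    have "cactus_eq n (us @ ?x # ?h) ([?t] @ ?x # ?h)"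
      using us_t h by (intro cactus_eq_append cactus_eq_refl)
    then have "chamber (us @ ?x # ?h) = reflect ?t (chamber (?x # ?h))"
      using chamber_cong by fastforce
    moreover have "ivl ?y \<noteq> ivl ?t" using cactus_gens_ivl_inj[OF y t] by simp
    ultimately have "chamber (us @ ?x # ?h) (ivl ?y) = chamber (?x # ?h) (ivl ?x)"
      using not_ov[OF y] refl_y by (simp add: reflect_not_overlap del: ivl_simp chamber_Cons)
    moreover have desc: "chamber (?x # ?h) (ivl ?x) < 0" using ch by blast
    ultimately have "chamber (us @ ?x # ?h) (ivl ?y) < 0" by metis
    then have False
      using commuting_descent_contradiction[OF us h _ disj desc _ overlap_sym[OF ov]] comm[OF x y]
      by simp
    then show ?thesis ..
  qed
qed

section \<open>The centralizer of the pure cactus group\<close>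

definition cactus_class :: "nat \<Rightarrow> (nat \<times> nat) list \<Rightarrow> (nat \<times> nat) word set"
  where "cactus_class n us = pres_rel (cactus_gens n) (cactus_rels n) `` {map (\<lambda>x. (x, True)) us}"

lemma cactus_class_eq_iff:
  assumes "us \<in> lists (cactus_gens n)" "vs \<in> lists (cactus_gens n)"
  shows "cactus_class n us = cactus_class n vs \<longleftrightarrow> cactus_eq n us vs"
  unfolding cactus_class_def cactus_eq_def
  using assms eq_equiv_class_iff[OF equiv_pres_rel[OF cactus_rels_words, of n]]
  by (simp add: pres_rel_def)

lemma cactus_class_append:
  assumes "us \<in> lists (cactus_gens n)" "vs \<in> lists (cactus_gens n)"
  shows "cactus_class n us \<otimes>\<^bsub>cactus_group n\<^esub> cactus_class n vs = cactus_class n (us @ vs)"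
  unfolding cactus_class_def cactus_group_def
  using assms by (simp add: presented_group_mult[OF cactus_rels_words])

lemma cactus_class_Nil: "cactus_class n [] = \<one>\<^bsub>cactus_group n\<^esub>"
  by (simp add: cactus_class_def cactus_group_def presented_group_def)

lemma cactus_class_closed: "us \<in> lists (cactus_gens n) \<Longrightarrow> cactus_class n us \<in> carrier (cactus_group n)"
  by (auto simp: cactus_class_def cactus_group_def presented_group_def quotient_def)

text \<open>An inverse letter is replaced by the letter itself: inserting the square of
  \<open>x\<close> behind the inverse and cancelling leaves \<open>x\<close>.\<close>

lemma pres_eq_positive_word:
  assumes "w \<in> words (cactus_gens n)"
  shows "pres_eq (cactus_gens n) (cactus_rels n) w (map (\<lambda>x. (x, True)) (map fst w))"
  using assms
proof (induction w)
  case Nil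
  then show ?case by (simp add: pres_eq_refl)
next
  case (Cons l w)
  obtain x b where l: "l = (x, b)" by fastforce
  have x: "x \<in> cactus_gens n" and w: "w \<in> words (cactus_gens n)" using Cons l by auto
  have "pres_eq (cactus_gens n) (cactus_rels n) [(x, b)] [(x, True)]"
  proof (cases b)
    case True
    then show ?thesis using x by (simp add: pres_eq_refl)
  next
    case False
    have "pres_eq (cactus_gens n) (cactus_rels n) ([(x, False)] @ [(x, True), (x, True)]) ([(x, False)] @ [])"
      using cactus_eq_square[OF x] x
      by (intro pres_eq_append[OF cactus_rels_words] pres_eq_refl) (auto simp: cactus_eq_def)
    moreover have "pres_eq (cactus_gens n) (cactus_rels n) [(x, False), (x, True), (x, True)] [(x, True)]"
      using pres_eq_cancel[of "[]" "cactus_gens n" "[(x, True)]" x "cactus_rels n" False] x by simp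
    ultimately show ?thesis
      using False by (auto intro: pres_eq_sym pres_eq_trans)
  qed
  then have "pres_eq (cactus_gens n) (cactus_rels n) ([(x, b)] @ w)
      ([(x, True)] @ map (\<lambda>x. (x, True)) (map fst w))"
    using Cons.IH[OF w] by (rule pres_eq_append[OF cactus_rels_words])
  then show ?case using l by simp
qed

lemma cactus_group_elem:
  assumes "g \<in> carrier (cactus_group n)"
  obtains us where "us \<in> lists (cactus_gens n)" "g = cactus_class n us"
proof -
  obtain w where w: "w \<in> words (cactus_gens n)" "g = pres_rel (cactus_gens n) (cactus_rels n) `` {w}"
    using assms by (auto simp: cactus_group_def presented_group_def quotient_def)
  have "g = cactus_class n (map fst w)"
    unfolding w(2) cactus_class_def
    using pres_eq_positive_word[OF w(1)]
    by (intro equiv_class_eq[OF equiv_pres_rel[OF cactus_rels_words]]) (simp add: pres_rel_def)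
  moreover have "map fst w \<in> lists (cactus_gens n)"
    using w(1) by (fastforce simp: words_def in_lists_conv_set)
  ultimately show ?thesis using that by blast
qed

text \<open>The symmetric group has order \<open>fact n\<close>, so every \<open>fact n\<close>-th
  power is mapped to the identity.\<close>

lemma alternating_pure:
  assumes "x \<in> cactus_gens n" "y \<in> cactus_gens n"
  shows "cactus_class n (alternating (fact n) x y) \<in> pure_cactus_group n"
proof -
  interpret J: group "cactus_group n" by (rule cactus_group_is_group)
  interpret S: group "sym_group n" by (rule sym_group_is_group)
  interpret h: group_hom "cactus_group n" "sym_group n" "cactus_perm n"
    by unfold_locales (rule cactus_perm_hom)
  let ?g = "cactus_class n [x, y]"
  have g: "?g \<in> carrier (cactus_group n)" using assms by (simp add: cactus_class_closed)
  have pow: "cactus_class n (alternating k x y) = ?g [^]\<^bsub>cactus_group n\<^esub> k" for k :: nat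
  proof (induction k)
    case 0
    then show ?case by (simp add: alternating_def cactus_class_Nil)
  next
    case (Suc k)
    have "cactus_class n (alternating (Suc k) x y)
        = ?g \<otimes>\<^bsub>cactus_group n\<^esub> cactus_class n (alternating k x y)"
      using assms alternating_lists[OF assms] by (simp add: cactus_class_append)
    then show ?case using Suc J.nat_pow_Suc2[OF g] by simp
  qed
  have "cactus_perm n ?g [^]\<^bsub>sym_group n\<^esub> order (sym_group n) = \<one>\<^bsub>sym_group n\<^esub>"
    using g by (intro S.pow_order_eq_1) simp
  moreover have "order (sym_group n) = fact n"
    by (simp add: order_def sym_group_card_carrier)
  ultimately show ?thesis
    using g unfolding pow pure_cactus_group_def kernel_def by (simp add: h.hom_nat_pow)
qed

theorem theorem4p2:
  fixes n :: nat
  assumes "n > 3"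
  shows "centralizer (cactus_group n) (pure_cactus_group n) = {\<one>\<^bsub>cactus_group n\<^esub>}"
proof -
  interpret J: group "cactus_group n" by (rule cactus_group_is_group)
  have pure: "pure_cactus_group n \<subseteq> carrier (cactus_group n)"
    by (auto simp: pure_cactus_group_def kernel_def)
  have "g = \<one>\<^bsub>cactus_group n\<^esub>" if g: "g \<in> centralizer (cactus_group n) (pure_cactus_group n)" for g
  proof -
    obtain us where us: "us \<in> lists (cactus_gens n)" "g = cactus_class n us"
      using g cactus_group_elem by (auto simp: centralizer_def)
    \<comment> \<open>The exponent \<open>fact n\<close> is positive, which makes the alternating
      words nonempty, as their descents require.\<close>
    obtain k where k: "fact n = Suc k"
      using fact_gt_zero gr0_implies_Suc by blast
    have "cactus_eq n us []"
    proof (rule commutes_alternating_imp_trivial[OF assms us(1)])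
      fix x y assume xy: "x \<in> cactus_gens n" "y \<in> cactus_gens n"
      let ?h = "alternating (Suc k) x y"
      have h: "?h \<in> lists (cactus_gens n)" using xy by (rule alternating_lists)
      have "cactus_class n ?h \<in> pure_cactus_group n"
        using alternating_pure[OF xy] k by simp
      then have "g \<otimes>\<^bsub>cactus_group n\<^esub> cactus_class n ?h = cactus_class n ?h \<otimes>\<^bsub>cactus_group n\<^esub> g"
        using g by (simp add: centralizer_def)
      then have "cactus_class n (us @ ?h) = cactus_class n (?h @ us)"
        using us h cactus_class_append by metis
      moreover have "us @ ?h \<in> lists (cactus_gens n)" "?h @ us \<in> lists (cactus_gens n)"
        using us(1) h by auto
      ultimately show "cactus_eq n (us @ ?h) (?h @ us)"
        using cactus_class_eq_iff by blast
    qed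
    then show ?thesis
      using us cactus_class_eq_iff[of us n "[]"] cactus_class_Nil by simp
  qed
  moreover have "\<one>\<^bsub>cactus_group n\<^esub> \<in> centralizer (cactus_group n) (pure_cactus_group n)"
    using pure by (auto simp: centralizer_def)
  ultimately show ?thesis by blast
qed

end
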